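(* Let $M$ be a compact two-point homogeneous space with distance function $\tau$, $\tau(x,x)=\tau_0$ for all $x\in M$, and zonal spherical functions $P_k(t)$, $k\ge 0$. Let $s\ge 2$ and let $X$ be an $s$-distance set in $M$ such that $\tau$ takes only the (distinct, real) values $\beta_1,\ldots,\beta_s$ on pairs of distinct points of $X$. Let $K$ be the dimension of the linear space of real functions on $M$ spanned by all functions $f_{Q,\xi}(x)=Q(\tau(x,\xi))$, where $\xi$ ranges over the points of $M$ and $Q$ over the real polynomials of degree $s-1$. For $1\le l\le s$ put $$k_l=-\prod_{i\ne l}\frac{\tau_0-\beta_i}{\beta_l-\beta_i}.$$ Assume that $|X|>1+K(s-1)$, and let $P(t)$ be any non-negative linear combination of the zonal spherical functions $P_k(t)$ of $M$. Then $$0\le (|X|-1-K(s-1))\bigl(P(\tau_0)+P(\beta_1)k_1+\ldots+P(\beta_s)k_s\bigr)\le |X|\,P(\tau_0).$$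
   Context: An $s$-distance set in a metric space is a finite set of points with exactly $s$ distinct pairwise distances between distinct points. A metric space $M$ with a group $G$ acting on it by isometries is two-point homogeneous if $G$ acts transitively on the ordered pairs of points at any given distance. Here $M$ is compact and $G$ is a connected compact group or a finite group; $\mu$ denotes the $G$-invariant measure on $M$ induced by the Haar measure of $G$, and $L^2(M)$ is the space of square-integrable complex functions on $M$ with inner product $(f_1,f_2)=\int_M f_1\overline{f_2}\,d\mu$. The space $L^2(M)$ decomposes into mutually orthogonal finite-dimensional subspaces $V^{(k)}$, $k=0,1,\ldots$ (consisting of continuous functions), each carrying an irreducible representation of $G$. With $h_k=\dim V^{(k)}$ and $e^{(k)}_1,\ldots,e^{(k)}_{h_k}$ an orthonormal basis of $V^{(k)}$, set $P_k(x,y)=\sum_{i=1}^{h_k}e^{(k)}_i(x)\overline{e^{(k)}_i(y)}$. By two-point homogeneity $P_k(x,y)$ depends only on the distance between $x$ and $y$; $P_k$ is called the zonal spherical function associated with $V^{(k)}$. The "distance function" $\tau(x,y)$ is a (possibly modified) real-valued distance function: $\tau(x,y)$ is a fixed injective function of the metric distance between $x$ and $y$ (for example, the scalar product $(x,y)$ on the sphere). One writes $P_k$ as a function of one variable, $P_k(x,y)=P_k(\tau(x,y))$, and $\tau_0=\tau(x,x)$. *)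

theory Defs
  imports
    "HOL-Analysis.Analysis"
    "HOL-Algebra.Group_Action"
    "HOL-Computational_Algebra.Polynomial"
    "HOL-Library.Function_Algebras"
begin

global_interpretation fun_space:
  vector_space "\<lambda>(c::'b::field) (f::'a \<Rightarrow> 'b) x. c * f x"
  by unfold_locales (auto simp: fun_eq_iff algebra_simps)

definition topological_group ::
  "('g, 'm) monoid_scheme \<Rightarrow> 'g topology \<Rightarrow> bool" where
  "topological_group G T \<longleftrightarrow>
     group G \<and> topspace T = carrier G \<and> Hausdorff_space T \<and>
     continuous_map (prod_topology T T) T (\<lambda>(g, h). g \<otimes>\<^bsub>G\<^esub> h) \<and>
     continuous_map T T (\<lambda>g. inv\<^bsub>G\<^esub> g)"

text \<open>Haar measure on the Borel sets of a compact group. The total mass is only required to be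
  positive and finite, so that both the probability normalisation and the counting measure
  of a finite group are covered.\<close>

definition haar_measure ::
  "('g, 'm) monoid_scheme \<Rightarrow> 'g topology \<Rightarrow> 'g measure \<Rightarrow> bool" where
  "haar_measure G T \<nu> \<longleftrightarrow>
     space \<nu> = carrier G \<and>
     sets \<nu> = sigma_sets (carrier G) {U. openin T U} \<and>
     0 < emeasure \<nu> (carrier G) \<and> emeasure \<nu> (carrier G) < \<infinity> \<and>
     (\<forall>g\<in>carrier G. \<forall>A\<in>sets \<nu>. emeasure \<nu> ((\<lambda>h. g \<otimes>\<^bsub>G\<^esub> h) ` A) = emeasure \<nu> A) \<and>
     (\<forall>A\<in>sets \<nu>. emeasure \<nu> A = (INF U\<in>{U. openin T U \<and> A \<subseteq> U}. emeasure \<nu> U)) \<and>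
     (\<forall>U. openin T U \<longrightarrow>
        emeasure \<nu> U = (SUP C\<in>{C. compactin T C \<and> C \<in> sets \<nu> \<and> C \<subseteq> U}. emeasure \<nu> C))"

text \<open>A finite group occurs with the discrete topology, its only Hausdorff topology.\<close>

locale compact_two_point_homogeneous =
  group_action G "UNIV :: 'a set" act
  for G :: "('g, 'm) monoid_scheme" (structure)
    and act :: "'g \<Rightarrow> 'a::metric_space \<Rightarrow> 'a" +
  fixes T :: "'g topology"
  assumes compact_space_M: "compact (UNIV :: 'a set)"
    and topological_group_G: "topological_group G T"
    and compact_G: "compact_space T"
    and connected_or_finite: "connected_space T \<or> finite (carrier G)"
    and continuous_act:
      "continuous_map (prod_topology T euclidean) euclidean (\<lambda>(g, x). act g x)"
    and isometry: "g \<in> carrier G \<Longrightarrow> dist (act g x) (act g y) = dist x y"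
    and two_point_transitive:
      "dist x y = dist x' y' \<Longrightarrow> \<exists>g\<in>carrier G. act g x = x' \<and> act g y = y'"

text \<open>\<open>distr\<close> along an orbit map: a set \<open>A\<close> gets the Haar measure of \<open>{g. g x\<^sub>0 \<in> A}\<close>;
  compact groups being unimodular, the choice of \<open>x\<^sub>0\<close> is immaterial.\<close>

definition induced_measure ::
  "'g measure \<Rightarrow> ('g \<Rightarrow> 'a \<Rightarrow> 'a::topological_space) \<Rightarrow> 'a \<Rightarrow> 'a measure" where
  "induced_measure \<nu> act x\<^sub>0 = distr \<nu> borel (\<lambda>g. act g x\<^sub>0)"

definition distance_function :: "('a::metric_space \<Rightarrow> 'a \<Rightarrow> real) \<Rightarrow> bool" where
  "distance_function \<tau> \<longleftrightarrow>
     (\<exists>\<phi>. inj_on \<phi> (range (\<lambda>(x::'a, y). dist x y)) \<and> (\<forall>x y. \<tau> x y = \<phi> (dist x y)))"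

definition s_distance_set :: "nat \<Rightarrow> 'a::metric_space set \<Rightarrow> bool" where
  "s_distance_set s X \<longleftrightarrow>
     finite X \<and> card {dist x y | x y. x \<in> X \<and> y \<in> X \<and> x \<noteq> y} = s"

definition L2 :: "'a measure \<Rightarrow> ('a \<Rightarrow> complex) set" where
  "L2 \<mu> = {f \<in> borel_measurable \<mu>. integrable \<mu> (\<lambda>x. (cmod (f x))\<^sup>2)}"

definition L2_inner :: "'a measure \<Rightarrow> ('a \<Rightarrow> complex) \<Rightarrow> ('a \<Rightarrow> complex) \<Rightarrow> complex" where
  "L2_inner \<mu> f g = (\<integral>x. f x * cnj (g x) \<partial>\<mu>)"

definition invariant_functions ::
  "('g, 'm) monoid_scheme \<Rightarrow> ('g \<Rightarrow> 'a \<Rightarrow> 'a) \<Rightarrow> ('a \<Rightarrow> complex) set \<Rightarrow> bool" where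
  "invariant_functions G act W \<longleftrightarrow>
     (\<forall>g\<in>carrier G. \<forall>f\<in>W. (\<lambda>x. f (act (inv\<^bsub>G\<^esub> g) x)) \<in> W)"

definition irreducible_functions ::
  "('g, 'm) monoid_scheme \<Rightarrow> ('g \<Rightarrow> 'a \<Rightarrow> 'a) \<Rightarrow> ('a \<Rightarrow> complex) set \<Rightarrow> bool" where
  "irreducible_functions G act W \<longleftrightarrow>
     fun_space.subspace W \<and> invariant_functions G act W \<and> W \<noteq> {0} \<and>
     (\<forall>W'. fun_space.subspace W' \<and> invariant_functions G act W' \<and> W' \<subseteq> W \<longrightarrow>
        W' = {0} \<or> W' = W)"

text \<open>The summands are indexed by a set \<open>I\<close> of naturals because there are only finitely many
  of them when the space is finite.\<close>

definition harmonic_decomposition ::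
  "('g, 'm) monoid_scheme \<Rightarrow> ('g \<Rightarrow> 'a \<Rightarrow> 'a::topological_space) \<Rightarrow> 'a measure \<Rightarrow>
   nat set \<Rightarrow> (nat \<Rightarrow> ('a \<Rightarrow> complex) set) \<Rightarrow> bool" where
  "harmonic_decomposition G act \<mu> I V \<longleftrightarrow>
     (\<forall>k\<in>I. irreducible_functions G act (V k) \<and>
        (\<exists>B. finite B \<and> V k = fun_space.span B) \<and>
        (\<forall>f\<in>V k. continuous_on UNIV f)) \<and>
     (\<forall>k\<in>I. \<forall>l\<in>I. k \<noteq> l \<longrightarrow> (\<forall>f\<in>V k. \<forall>g\<in>V l. L2_inner \<mu> f g = 0)) \<and>
     (\<forall>f\<in>L2 \<mu>. \<forall>\<epsilon>>0. \<exists>F g. finite F \<and> F \<subseteq> I \<and> (\<forall>k\<in>F. g k \<in> V k) \<and>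
        (\<integral>x. (cmod (f x - (\<Sum>k\<in>F. g k x)))\<^sup>2 \<partial>\<mu>) < \<epsilon>)"

definition orthonormal_basis ::
  "'a measure \<Rightarrow> ('a \<Rightarrow> complex) set \<Rightarrow> (nat \<Rightarrow> 'a \<Rightarrow> complex) \<Rightarrow> bool" where
  "orthonormal_basis \<mu> W e \<longleftrightarrow>
     (let h = fun_space.dim W in
       (\<forall>i\<in>{1..h}. \<forall>j\<in>{1..h}. L2_inner \<mu> (e i) (e j) = (if i = j then 1 else 0)) \<and>
       fun_space.span (e ` {1..h}) = W)"

definition zonal_kernel ::
  "nat \<Rightarrow> (nat \<Rightarrow> 'a \<Rightarrow> complex) \<Rightarrow> 'a \<Rightarrow> 'a \<Rightarrow> complex" where
  "zonal_kernel h e x y = (\<Sum>i=1..h. e i x * cnj (e i y))"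

text \<open>The kernel as a function of the single variable \<open>t = \<tau> x y\<close>. On a two-point homogeneous space
  it is real and depends only on \<open>\<tau> x y\<close>, so the value is determined for each \<open>t\<close> in the range
  of \<open>\<tau>\<close>; elsewhere it is unspecified.\<close>

definition zonal_function ::
  "('a \<Rightarrow> 'a \<Rightarrow> real) \<Rightarrow> nat \<Rightarrow> (nat \<Rightarrow> 'a \<Rightarrow> complex) \<Rightarrow> real \<Rightarrow> real" where
  "zonal_function \<tau> h e t =
     (THE r. \<forall>x y. \<tau> x y = t \<longrightarrow> zonal_kernel h e x y = complex_of_real r)"

definition poly_functions :: "('a \<Rightarrow> 'a \<Rightarrow> real) \<Rightarrow> nat \<Rightarrow> ('a \<Rightarrow> real) set" where
  "poly_functions \<tau> d = {\<lambda>x. poly Q (\<tau> x \<xi>) | Q \<xi>. degree Q = d}"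

text \<open>\<open>dim\<close> is 0 by convention on infinite-dimensional spaces, hence an explicit finite basis.\<close>

definition span_has_dimension :: "('a \<Rightarrow> real) set \<Rightarrow> nat \<Rightarrow> bool" where
  "span_has_dimension S K \<longleftrightarrow>
     (\<exists>B. finite B \<and> fun_space.independent B \<and>
        fun_space.span B = fun_space.span S \<and> card B = K)"

definition k_coeff :: "real \<Rightarrow> nat \<Rightarrow> (nat \<Rightarrow> real) \<Rightarrow> nat \<Rightarrow> real" where
  "k_coeff \<tau>\<^sub>0 s \<beta> l = - (\<Prod>i\<in>{1..s} - {l}. (\<tau>\<^sub>0 - \<beta> i) / (\<beta> l - \<beta> i))"

end

theory Submission
  imports Defs
begin

text \<open>Let \<open>W\<close> be a basis of the span of the functions \<open>Q (\<tau> x \<xi>)\<close>. A vector on \<open>X\<close> orthogonal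
  to the \<open>K\<close> elements of \<open>W\<close> is annihilated by the matrix \<open>L\<^sub>l (\<tau> x y)\<close> of every Lagrange
  polynomial \<open>L\<^sub>l\<close> with nodes \<open>\<beta>\<^sub>i\<close>. On \<open>X\<close> the matrix \<open>P (\<tau> x y)\<close> is a linear combination of these
  matrices plus \<open>a\<close> times the identity, where \<open>a = P \<tau>\<^sub>0 + (\<Sum>l. P \<beta>\<^sub>l * k\<^sub>l)\<close>. Hence \<open>a\<close> is an
  eigenvalue of multiplicity at least \<open>|X| - K\<close>. Since \<open>P (\<tau> x y)\<close> is positive semidefinite with trace
  \<open>|X| * P \<tau>\<^sub>0\<close>, it follows that \<open>a \<ge> 0\<close> and \<open>(|X| - K) * a \<le> |X| * P \<tau>\<^sub>0\<close>, and
  \<open>|X| - 1 - K * (s - 1) \<le> |X| - K\<close> because \<open>s \<ge> 2\<close>.\<close>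

lemma sum_fun_apply: "(\<Sum>a\<in>A. f a) x = (\<Sum>a\<in>A. f a x)"
  by (induction A rule: infinite_finite_induct) auto

section \<open>Vectors orthogonal to few functions\<close>

text \<open>A point \<open>x\<close> gives the vector of the values \<open>w x\<close> for
  \<open>w\<close> in \<open>W\<close>. These \<open>card X\<close> vectors lie in a space of
  dimension at most \<open>card W\<close>, so they satisfy a nontrivial linear relation, whose
  coefficients form \<open>v\<close>.\<close>

lemma ex_orthogonal_nonzero:
  fixes X :: "'a set" and W :: "('a \<Rightarrow> real) set"
  assumes "finite X" "finite W" "card W < card X"
  obtains v where "\<exists>x\<in>X. v x \<noteq> 0" "\<And>w. w \<in> W \<Longrightarrow> (\<Sum>x\<in>X. v x * w x) = 0"
proof -
  \<comment> \<open>Cutting off outside \<open>W\<close> places every \<open>ev x\<close> in the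
    span of the finitely many indicators \<open>unit w\<close>.\<close>
  define ev where "ev x = (\<lambda>w. if w \<in> W then w x else 0)" for x :: 'a
  show ?thesis
  proof (cases "inj_on ev X")
    case False
    then obtain x y where xy: "x \<in> X" "y \<in> X" "x \<noteq> y" "ev x = ev y"
      unfolding inj_on_def by blast
    define v where "v = (\<lambda>z. of_bool (z = x) - of_bool (z = y) :: real)"
    show ?thesis
    proof (rule that)
      show "\<exists>z\<in>X. v z \<noteq> 0"
        using xy by (intro bexI[of _ x]) (auto simp: v_def)
    next
      fix w assume "w \<in> W"
      then have "w x = w y"
        using fun_cong[OF xy(4), of w] by (simp add: ev_def)
      then show "(\<Sum>z\<in>X. v z * w z) = 0"
        using xy assms(1) by (simp add: v_def left_diff_distrib sum_subtractf)
    qed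
  next
    case True
    define unit where "unit w = (\<lambda>w'. of_bool (w' = w) :: real)" for w :: "'a \<Rightarrow> real"
    have "ev x \<in> fun_space.span (unit ` W)" for x
    proof -
      have "ev x = (\<Sum>w\<in>W. (\<lambda>w'. w x * unit w w'))"
        using assms(2)
        by (intro ext) (simp add: ev_def unit_def sum_fun_apply of_bool_def if_distrib cong: if_cong)
      also have "\<dots> \<in> fun_space.span (unit ` W)"
        by (intro fun_space.span_sum fun_space.span_scale fun_space.span_base imageI)
      finally show ?thesis .
    qed
    then have "ev ` X \<subseteq> fun_space.span (unit ` W)"
      by blast
    moreover have "card (ev ` X) > card (unit ` W)"
      using card_image[OF True] card_image_le[OF assms(2), of unit] assms(3) by linarith
    ultimately have "fun_space.dependent (ev ` X)"
      using fun_space.independent_span_bound[of "unit ` W" "ev ` X"] assms(2) by force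
    then obtain u where u: "\<exists>p\<in>ev ` X. u p \<noteq> 0" "(\<Sum>p\<in>ev ` X. (\<lambda>w. u p * p w)) = 0"
      using fun_space.dependent_finite[of "ev ` X"] assms(1) by auto
    show ?thesis
    proof (rule that)
      show "\<exists>x\<in>X. u (ev x) \<noteq> 0"
        using u(1) by blast
    next
      fix w assume "w \<in> W"
      then have "ev x w = w x" for x
        by (simp add: ev_def)
      then show "(\<Sum>x\<in>X. u (ev x) * w x) = 0"
        using fun_cong[OF u(2), of w] by (simp add: sum_fun_apply sum.reindex[OF True])
    qed
  qed
qed

text \<open>Each new vector is taken orthogonal to \<open>W\<close> and to the vectors already
  found. These are at most \<open>card W + m\<close> functions, which is below \<open>card X\<close>
  as long as another vector is wanted. Only normalisation remains, with no projection step.\<close>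

lemma ex_orthonormal_orthogonal:
  fixes X :: "'a set" and W :: "('a \<Rightarrow> real) set"
  assumes "finite X" "finite W" "m + card W \<le> card X"
  shows "\<exists>u :: nat \<Rightarrow> 'a \<Rightarrow> real.
    (\<forall>i<m. \<forall>j<m. (\<Sum>x\<in>X. u i x * u j x) = of_bool (i = j)) \<and>
    (\<forall>i<m. \<forall>w\<in>W. (\<Sum>x\<in>X. u i x * w x) = 0)"
  using assms(3)
proof (induction m)
  case (Suc m)
  then obtain u :: "nat \<Rightarrow> 'a \<Rightarrow> real" where u:
    "\<forall>i<m. \<forall>j<m. (\<Sum>x\<in>X. u i x * u j x) = of_bool (i = j)"
    "\<forall>i<m. \<forall>w\<in>W. (\<Sum>x\<in>X. u i x * w x) = 0"
    by auto
  have "card (W \<union> u ` {..<m}) \<le> card W + m"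
    using card_Un_le[of W "u ` {..<m}"] card_image_le[of "{..<m}" u] by simp
  then have "card (W \<union> u ` {..<m}) < card X"
    using Suc.prems by simp
  then obtain v where v: "\<exists>x\<in>X. v x \<noteq> 0"
    "\<And>w. w \<in> W \<union> u ` {..<m} \<Longrightarrow> (\<Sum>x\<in>X. v x * w x) = 0"
    using ex_orthogonal_nonzero[of X "W \<union> u ` {..<m}"] assms(1,2) by blast
  define r where "r = (\<Sum>x\<in>X. (v x)\<^sup>2)"
  have "r > 0"
    unfolding r_def using v(1) assms(1) by (auto intro: sum_pos2)
  define v' where "v' x = v x / sqrt r" for x
  have v'_orth: "(\<Sum>x\<in>X. v' x * w x) = 0" if "w \<in> W \<union> u ` {..<m}" for w
    using v(2)[OF that] by (simp add: v'_def flip: sum_divide_distrib)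
  have v'_norm: "(\<Sum>x\<in>X. v' x * v' x) = 1"
  proof -
    have "(\<Sum>x\<in>X. v' x * v' x) = (\<Sum>x\<in>X. (v x)\<^sup>2 / r)"
      using \<open>r > 0\<close> by (simp add: v'_def power2_eq_square)
    also have "\<dots> = 1"
      using \<open>r > 0\<close> by (simp add: r_def flip: sum_divide_distrib)
    finally show ?thesis .
  qed
  have "(\<Sum>x\<in>X. v' x * u i x) = 0" "(\<Sum>x\<in>X. u i x * v' x) = 0" if "i < m" for i
    using v'_orth[of "u i"] that by (auto simp: mult.commute)
  then show ?case
    using u v'_norm v'_orth by (intro exI[of _ "u(m := v')"]) (auto simp: less_Suc_eq)
qed auto

text \<open>The eigenspace of \<open>a\<close> has dimension at least \<open>card X - card W\<close>
  and the remaining eigenvalues are non-negative, so the trace dominates \<open>a\<close> times this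
  dimension. In place of a diagonalisation, the diagonal of \<open>B\<close> is compared with that
  of \<open>a\<close> times the projection to the span of the orthonormal
  \<open>u i\<close>.\<close>

lemma psd_eigenvalue_trace_bounds:
  fixes B :: "'a \<Rightarrow> 'a \<Rightarrow> real" and W :: "('a \<Rightarrow> real) set"
  assumes "finite X" "finite W" "card W < card X"
    and sym: "\<And>x y. x \<in> X \<Longrightarrow> y \<in> X \<Longrightarrow> B x y = B y x"
    and psd: "\<And>v. 0 \<le> (\<Sum>x\<in>X. \<Sum>y\<in>X. v x * v y * B x y)"
    and eig: "\<And>v x. x \<in> X \<Longrightarrow> (\<And>w. w \<in> W \<Longrightarrow> (\<Sum>y\<in>X. v y * w y) = 0) \<Longrightarrow>
      (\<Sum>y\<in>X. B x y * v y) = a * v x"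
  shows "0 \<le> a" "(real (card X) - real (card W)) * a \<le> (\<Sum>x\<in>X. B x x)"
proof -
  define m where "m = card X - card W"
  have "m + card W \<le> card X" "0 < m"
    using assms(3) by (auto simp: m_def)
  then obtain u :: "nat \<Rightarrow> 'a \<Rightarrow> real" where
    on: "\<forall>i<m. \<forall>j<m. (\<Sum>x\<in>X. u i x * u j x) = of_bool (i = j)" and
    orth: "\<forall>i<m. \<forall>w\<in>W. (\<Sum>x\<in>X. u i x * w x) = 0"
    using ex_orthonormal_orthogonal[of X W m] assms(1,2) by auto
  have Bu: "(\<Sum>y\<in>X. B x y * u i y) = a * u i x" if "i < m" "x \<in> X" for i x
    using eig[of x "u i"] orth that by blast
  have "(\<Sum>x\<in>X. \<Sum>y\<in>X. u 0 x * u 0 y * B x y) = (\<Sum>x\<in>X. u 0 x * (\<Sum>y\<in>X. B x y * u 0 y))"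
    by (simp add: sum_distrib_left mult_ac)
  also have "\<dots> = (\<Sum>x\<in>X. a * (u 0 x * u 0 x))"
    using Bu \<open>0 < m\<close> by (simp add: mult_ac)
  also have "\<dots> = a"
    using on \<open>0 < m\<close> by (simp flip: sum_distrib_left)
  finally show "0 \<le> a"
    using psd[of "u 0"] by simp
  \<comment> \<open>Apply positivity to the projection of a basis vector to the complement of the \<open>u i\<close>.\<close>
  have diag: "a * (\<Sum>i<m. (u i x)\<^sup>2) \<le> B x x" if x: "x \<in> X" for x
  proof -
    define w where "w y = of_bool (y = x) - (\<Sum>i<m. u i x * u i y)" for y
    have Bw: "(\<Sum>z\<in>X. B y z * w z) = B y x - a * (\<Sum>i<m. u i x * u i y)" if "y \<in> X" for y
    proof -
      have "(\<Sum>z\<in>X. B y z * w z) = B y x - (\<Sum>z\<in>X. \<Sum>i<m. u i x * (B y z * u i z))"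
        using x assms(1)
        by (simp add: w_def right_diff_distrib sum_subtractf sum_distrib_left mult_ac)
      also have "(\<Sum>z\<in>X. \<Sum>i<m. u i x * (B y z * u i z)) = (\<Sum>i<m. u i x * (\<Sum>z\<in>X. B y z * u i z))"
        by (subst sum.swap) (simp add: sum_distrib_left)
      also have "\<dots> = a * (\<Sum>i<m. u i x * u i y)"
        using Bu that by (simp add: sum_distrib_left mult_ac)
      finally show ?thesis .
    qed
    have uw: "(\<Sum>y\<in>X. u j y * w y) = 0" if "j < m" for j
    proof -
      have "(\<Sum>y\<in>X. u j y * w y) = u j x - (\<Sum>y\<in>X. \<Sum>i<m. u i x * (u j y * u i y))"
        using x assms(1)
        by (simp add: w_def right_diff_distrib sum_subtractf sum_distrib_left mult_ac)
      also have "(\<Sum>y\<in>X. \<Sum>i<m. u i x * (u j y * u i y)) = (\<Sum>i<m. u i x * (\<Sum>y\<in>X. u j y * u i y))"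
        by (subst sum.swap) (simp add: sum_distrib_left)
      also have "\<dots> = (\<Sum>i<m. u i x * of_bool (j = i))"
        using on that by (intro sum.cong) auto
      also have "\<dots> = u j x"
        using that by (simp add: of_bool_def if_distrib cong: if_cong)
      finally show ?thesis by simp
    qed
    \<comment> \<open>Since \<open>w\<close> is orthogonal to every \<open>u i\<close>, its
      quadratic form reduces to the entry at \<open>x\<close> of \<open>B\<close> applied to
      \<open>w\<close>. By \<open>Bw\<close> this is the difference of the two sides of the
      claim.\<close>
    have "(\<Sum>y\<in>X. \<Sum>z\<in>X. w y * w z * B y z) = (\<Sum>y\<in>X. w y * (\<Sum>z\<in>X. B y z * w z))"
      by (simp add: sum_distrib_left mult_ac)
    also have "\<dots> = (\<Sum>y\<in>X. B x y * w y) - (\<Sum>y\<in>X. \<Sum>i<m. a * u i x * (u i y * w y))"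
      using Bw sym[OF x]
      by (simp add: right_diff_distrib sum_subtractf sum_distrib_left mult_ac)
    also have "(\<Sum>y\<in>X. \<Sum>i<m. a * u i x * (u i y * w y)) =
        (\<Sum>i<m. a * u i x * (\<Sum>y\<in>X. u i y * w y))"
      by (subst sum.swap) (simp add: sum_distrib_left)
    also have "\<dots> = 0"
      using uw by simp
    finally show ?thesis
      using psd[of w] Bw[OF x] by (simp add: power2_eq_square)
  qed
  \<comment> \<open>The \<open>u i\<close> are unit vectors, so the diagonal of the projection to
    their span sums to \<open>m\<close>.\<close>
  have "(real (card X) - real (card W)) * a = (\<Sum>i<m. a * (\<Sum>x\<in>X. u i x * u i x))"
    using on assms(3) by (simp add: m_def of_nat_diff)
  also have "\<dots> = (\<Sum>x\<in>X. a * (\<Sum>i<m. (u i x)\<^sup>2))"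
    by (simp add: sum_distrib_left power2_eq_square sum.swap[of _ X])
  also have "\<dots> \<le> (\<Sum>x\<in>X. B x x)"
    by (intro sum_mono diag)
  finally show "(real (card X) - real (card W)) * a \<le> (\<Sum>x\<in>X. B x x)" .
qed

section \<open>Lagrange polynomials\<close>

text \<open>For the nodes of the theorem, \<open>k_coeff\<close> is minus the value of this
  polynomial at \<open>\<tau>\<^sub>0\<close>.\<close>

definition lagrange_poly :: "'i set \<Rightarrow> ('i \<Rightarrow> 'b::field) \<Rightarrow> 'i \<Rightarrow> 'b poly" where
  "lagrange_poly I \<beta> l = (\<Prod>i\<in>I - {l}. smult (1 / (\<beta> l - \<beta> i)) [:- \<beta> i, 1:])"

lemma poly_lagrange_poly:
  "poly (lagrange_poly I \<beta> l) t = (\<Prod>i\<in>I - {l}. (t - \<beta> i) / (\<beta> l - \<beta> i))"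
  by (simp add: lagrange_poly_def poly_prod diff_divide_distrib)

lemma poly_lagrange_poly_node:
  assumes "finite I" "inj_on \<beta> I" "l \<in> I" "m \<in> I"
  shows "poly (lagrange_poly I \<beta> l) (\<beta> m) = of_bool (l = m)"
proof (cases "l = m")
  case True
  have "(\<beta> l - \<beta> i) / (\<beta> l - \<beta> i) = 1" if "i \<in> I - {l}" for i
    using that assms(2,3) by (auto simp: inj_on_def)
  then show ?thesis
    using True by (simp add: poly_lagrange_poly)
next
  case False
  then show ?thesis
    using assms by (auto simp: poly_lagrange_poly prod_zero_iff)
qed

text \<open>Distinct nodes make every factor exactly linear. The exact degree matters, because
  \<open>poly_functions\<close> admits only polynomials of degree equal to \<open>d\<close>.\<close>

lemma degree_lagrange_poly:
  assumes "finite I" "inj_on \<beta> I" "l \<in> I"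
  shows "degree (lagrange_poly I \<beta> l) = card I - 1"
proof -
  have ne: "\<beta> l - \<beta> i \<noteq> 0" if "i \<in> I - {l}" for i
    using that assms(2,3) by (auto simp: inj_on_def)
  then have "degree (lagrange_poly I \<beta> l) = (\<Sum>i\<in>I - {l}. degree (smult (1 / (\<beta> l - \<beta> i)) [:- \<beta> i, 1:]))"
    unfolding lagrange_poly_def by (intro degree_prod_eq_sum_degree) auto
  also have "\<dots> = (\<Sum>i\<in>I - {l}. 1)"
    using ne by (intro sum.cong) auto
  also have "\<dots> = card I - 1"
    using assms by simp
  finally show ?thesis .
qed

text \<open>Only values at the nodes are compared, so \<open>f\<close> may be an arbitrary function;
  it is later applied to \<open>P\<close>.\<close>

lemma poly_lagrange_expansion:
  assumes "finite I" "inj_on \<beta> I" "m \<in> I"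
  shows "f (\<beta> m) = (\<Sum>l\<in>I. f (\<beta> l) * poly (lagrange_poly I \<beta> l) (\<beta> m))"
proof -
  have "(\<Sum>l\<in>I. f (\<beta> l) * poly (lagrange_poly I \<beta> l) (\<beta> m)) = (\<Sum>l\<in>I. f (\<beta> l) * of_bool (l = m))"
    using assms by (intro sum.cong) (auto simp: poly_lagrange_poly_node)
  then show ?thesis
    using assms by simp
qed

section \<open>The invariant measure\<close>

context compact_two_point_homogeneous
begin

lemma is_group: "group G"
  using topological_group_G by (simp add: topological_group_def)

lemma act_mult:
  "g \<in> carrier G \<Longrightarrow> h \<in> carrier G \<Longrightarrow> act (g \<otimes> h) x = act g (act h x)"
  by (rule composition_rule) auto

lemma act_inv_act: "g \<in> carrier G \<Longrightarrow> act (inv g) (act g x) = x"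
  by (rule orbit_sym_aux) auto

lemma continuous_on_act:
  assumes "g \<in> carrier G"
  shows "continuous_on UNIV (act g)"
proof -
  have "dist (act g x) (act g y) \<le> 1 * dist x y" for x y
    using isometry[OF assms, of x y] by simp
  then have "1-lipschitz_on UNIV (act g)"
    by (intro lipschitz_onI) auto
  then show ?thesis
    by (rule lipschitz_on_continuous_on)
qed

lemma topspace_T: "topspace T = carrier G"
  using topological_group_G by (simp add: topological_group_def)

lemma continuous_map_mult_left:
  assumes "g \<in> carrier G"
  shows "continuous_map T T (\<lambda>h. g \<otimes> h)"
proof -
  have pair: "continuous_map T (prod_topology T T) (\<lambda>h. (g, h))"
    using assms topspace_T by (simp add: continuous_map_paired)
  have mult: "continuous_map (prod_topology T T) T (\<lambda>(g, h). g \<otimes> h)"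
    using topological_group_G by (simp add: topological_group_def)
  show ?thesis
    using continuous_map_compose[OF pair mult] by (simp add: o_def)
qed

lemma continuous_map_orbit: "continuous_map T euclidean (\<lambda>g. act g x)"
proof -
  have "continuous_map T (prod_topology T euclidean) (\<lambda>g. (g, x))"
    by (simp add: continuous_map_paired)
  from continuous_map_compose[OF this continuous_act] show ?thesis
    by (simp add: o_def)
qed

end

locale haar_two_point_homogeneous =
  compact_two_point_homogeneous G act T
  for G :: "('g, 'm) monoid_scheme" (structure)
    and act :: "'g \<Rightarrow> 'a::metric_space \<Rightarrow> 'a" and T :: "'g topology" +
  fixes \<nu> :: "'g measure" and \<mu> :: "'a measure" and x\<^sub>0 :: 'a
  assumes haar: "haar_measure G T \<nu>"
    and \<mu>_eq: "\<mu> = induced_measure \<nu> act x\<^sub>0"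
begin

lemma space_\<nu>: "space \<nu> = carrier G"
  and sets_\<nu>: "sets \<nu> = sigma_sets (carrier G) {U. openin T U}"
  using haar by (auto simp: haar_measure_def)

lemma emeasure_\<nu>_translate:
  "g \<in> carrier G \<Longrightarrow> A \<in> sets \<nu> \<Longrightarrow> emeasure \<nu> ((\<lambda>h. g \<otimes> h) ` A) = emeasure \<nu> A"
  using haar by (auto simp: haar_measure_def)

lemma openin_sets_\<nu>: "openin T U \<Longrightarrow> U \<in> sets \<nu>"
  by (auto simp: sets_\<nu>)

lemma measurable_mult_left:
  assumes "g \<in> carrier G"
  shows "(\<lambda>h. g \<otimes> h) \<in> measurable \<nu> \<nu>"
proof (rule measurable_sigma_sets[OF sets_\<nu>])
  show "{U. openin T U} \<subseteq> Pow (carrier G)"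
    using openin_subset topspace_T by blast
  show "(\<lambda>h. g \<otimes> h) \<in> space \<nu> \<rightarrow> carrier G"
    using assms is_group by (auto simp: space_\<nu> group.subgroup_self subgroup.m_closed)
  show "(\<lambda>h. g \<otimes> h) -` U \<inter> space \<nu> \<in> sets \<nu>" if "U \<in> {U. openin T U}" for U
  proof -
    have "openin T {h \<in> topspace T. g \<otimes> h \<in> U}"
      using continuous_map_mult_left[OF assms] that by (auto intro: openin_continuous_map_preimage)
    moreover have "{h \<in> topspace T. g \<otimes> h \<in> U} = (\<lambda>h. g \<otimes> h) -` U \<inter> space \<nu>"
      by (auto simp: topspace_T space_\<nu>)
    ultimately show ?thesis
      using openin_sets_\<nu> by simp
  qed
qed

lemma measurable_orbit: "(\<lambda>g. act g x) \<in> borel_measurable \<nu>"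
proof (rule borel_measurableI)
  fix S :: "'a set" assume "open S"
  then have "openin T {g \<in> topspace T. act g x \<in> S}"
    using openin_continuous_map_preimage[OF continuous_map_orbit] by simp
  moreover have "{g \<in> topspace T. act g x \<in> S} = (\<lambda>g. act g x) -` S \<inter> space \<nu>"
    by (auto simp: topspace_T space_\<nu>)
  ultimately show "(\<lambda>g. act g x) -` S \<inter> space \<nu> \<in> sets \<nu>"
    using openin_sets_\<nu> by simp
qed

text \<open>Haar invariance is given for images, whereas \<open>distr\<close> takes preimages. The
  preimage of \<open>A\<close> under multiplication by \<open>g\<close> is its image under
  multiplication by \<open>inv g\<close>.\<close>

lemma distr_mult_left:
  assumes "g \<in> carrier G"
  shows "distr \<nu> \<nu> (\<lambda>h. g \<otimes> h) = \<nu>"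
proof (rule measure_eqI)
  interpret group G by (rule is_group)
  fix A assume "A \<in> sets (distr \<nu> \<nu> (\<lambda>h. g \<otimes> h))"
  then have A: "A \<in> sets \<nu>" by simp
  then have sub: "A \<subseteq> carrier G"
    using sets.sets_into_space space_\<nu> by blast
  have "(\<lambda>h. g \<otimes> h) -` A \<inter> space \<nu> = (\<lambda>h. inv g \<otimes> h) ` A"
  proof (intro equalityI subsetI)
    fix h assume "h \<in> (\<lambda>h. g \<otimes> h) -` A \<inter> space \<nu>"
    then show "h \<in> (\<lambda>h. inv g \<otimes> h) ` A"
      using assms by (intro image_eqI[of _ _ "g \<otimes> h"]) (auto simp: space_\<nu> simp flip: m_assoc)
  next
    fix h assume "h \<in> (\<lambda>h. inv g \<otimes> h) ` A"
    then show "h \<in> (\<lambda>h. g \<otimes> h) -` A \<inter> space \<nu>"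
      using assms sub by (auto simp: space_\<nu> simp flip: m_assoc)
  qed
  then show "emeasure (distr \<nu> \<nu> (\<lambda>h. g \<otimes> h)) A = emeasure \<nu> A"
    using A assms measurable_mult_left emeasure_\<nu>_translate[of "inv g"]
    by (simp add: emeasure_distr)
qed simp

lemma sets_\<mu> [simp]: "sets \<mu> = sets borel"
  and space_\<mu> [simp]: "space \<mu> = UNIV"
  by (simp_all add: \<mu>_eq induced_measure_def)

lemma measurable_\<mu> [simp]: "measurable \<mu> = measurable borel"
  by (auto simp: fun_eq_iff measurable_def)

lemma finite_measure_\<mu>: "finite_measure \<mu>"
proof (rule finite_measureI)
  have "emeasure \<mu> (space \<mu>) = emeasure \<nu> (carrier G)"
    using measurable_orbit by (simp add: \<mu>_eq induced_measure_def emeasure_distr space_\<nu>)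
  then show "emeasure \<mu> (space \<mu>) \<noteq> \<infinity>"
    using haar by (auto simp: haar_measure_def)
qed

text \<open>Compactness bounds \<open>f\<close>, and \<open>\<mu>\<close> is finite.\<close>

lemma integrable_continuous:
  fixes f :: "'a \<Rightarrow> complex"
  assumes "continuous_on UNIV f"
  shows "integrable \<mu> f"
proof -
  have "compact (range f)"
    using compact_continuous_image[OF assms compact_space_M] .
  then obtain C where C: "\<And>x. norm (f x) \<le> C"
    using compact_imp_bounded bounded_iff by (metis rangeI)
  show ?thesis
    by (rule finite_measure.integrable_const_bound[OF finite_measure_\<mu>, of _ C])
      (use C assms borel_measurable_continuous_onI in auto)
qed

text \<open>Pulled back along the orbit map of \<open>x\<^sub>0\<close>, the action of
  \<open>g\<close> becomes left multiplication by \<open>g\<close>, which preserves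
  \<open>\<nu>\<close>.\<close>

lemma integral_act:
  fixes f :: "'a \<Rightarrow> complex"
  assumes "continuous_on UNIV f" "g \<in> carrier G"
  shows "(\<integral>x. f (act g x) \<partial>\<mu>) = (\<integral>x. f x \<partial>\<mu>)"
proof -
  have f: "f \<in> borel_measurable borel"
    using assms borel_measurable_continuous_onI by blast
  have orbit: "(\<integral>x. F x \<partial>\<mu>) = (\<integral>h. F (act h x\<^sub>0) \<partial>\<nu>)" if "F \<in> borel_measurable borel"
    for F :: "'a \<Rightarrow> complex"
    unfolding \<mu>_eq induced_measure_def using that measurable_orbit by (intro integral_distr) auto
  have fg: "(\<lambda>x. f (act g x)) \<in> borel_measurable borel"
    using continuous_on_act[OF assms(2)] assms(1)
    by (intro borel_measurable_continuous_onI continuous_on_compose2[OF assms(1)]) auto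
  have "(\<integral>x. f (act g x) \<partial>\<mu>) = (\<integral>h. f (act g (act h x\<^sub>0)) \<partial>\<nu>)"
    by (rule orbit[OF fg])
  also have "\<dots> = (\<integral>h. f (act (g \<otimes> h) x\<^sub>0) \<partial>\<nu>)"
    using assms(2) by (intro Bochner_Integration.integral_cong) (auto simp: space_\<nu> act_mult)
  also have "\<dots> = (\<integral>h. f (act h x\<^sub>0) \<partial>(distr \<nu> \<nu> (\<lambda>h. g \<otimes> h)))"
    using measurable_compose[OF measurable_orbit f] measurable_mult_left[OF assms(2)]
    by (intro integral_distr[symmetric]) auto
  also have "\<dots> = (\<integral>x. f x \<partial>\<mu>)"
    using orbit[OF f] distr_mult_left[OF assms(2)] by simp
  finally show ?thesis .
qed

section \<open>Invariance of the zonal kernel\<close>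

lemma L2_inner_sum_left:
  assumes "\<And>i. i \<in> A \<Longrightarrow> continuous_on UNIV (f i)" "continuous_on UNIV g"
  shows "L2_inner \<mu> (\<lambda>x. \<Sum>i\<in>A. a i * f i x) g = (\<Sum>i\<in>A. a i * L2_inner \<mu> (f i) g)"
proof -
  have "integrable \<mu> (\<lambda>x. a i * (f i x * cnj (g x)))" if "i \<in> A" for i
    using assms that by (intro integrable_continuous continuous_intros)
  then show ?thesis
    unfolding L2_inner_def by (simp add: sum_distrib_right mult.assoc)
qed

lemma L2_inner_commute: "L2_inner \<mu> f g = cnj (L2_inner \<mu> g f)"
  unfolding L2_inner_def by (subst Bochner_Integration.integral_cnj[symmetric]) (simp add: mult.commute)

text \<open>The action is unitary: substitute \<open>act g x\<close> for \<open>x\<close> in the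
  integral on the right-hand side.\<close>

lemma L2_inner_act:
  assumes "continuous_on UNIV f" "continuous_on UNIV f'" "g \<in> carrier G"
  shows "L2_inner \<mu> (\<lambda>x. f (act g x)) f' = L2_inner \<mu> f (\<lambda>x. f' (act (inv g) x))"
proof -
  have inv: "inv g \<in> carrier G"
    using assms(3) is_group by (simp add: group.inv_closed)
  have "continuous_on UNIV (\<lambda>x. f x * cnj (f' (act (inv g) x)))"
    using continuous_on_act[OF inv]
    by (intro continuous_intros assms(1) continuous_on_compose2[OF assms(2)]) auto
  from integral_act[OF this assms(3)] show ?thesis
    by (simp add: L2_inner_def act_inv_act[OF assms(3)])
qed

context
  fixes V :: "('a \<Rightarrow> complex) set" and e :: "nat \<Rightarrow> 'a \<Rightarrow> complex" and h :: nat
  assumes subspace: "fun_space.subspace V"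
    and invariant: "invariant_functions G act V"
    and continuous: "\<And>f. f \<in> V \<Longrightarrow> continuous_on UNIV f"
    and basis: "orthonormal_basis \<mu> V e"
    and h_eq: "h = fun_space.dim V"
begin

lemma basis_mem: "i \<in> {1..h} \<Longrightarrow> e i \<in> V"
  using basis fun_space.span_base[of "e i" "e ` {1..h}"]
  by (auto simp: orthonormal_basis_def Let_def h_eq)

lemma expansion:
  assumes "f \<in> V"
  shows "f x = (\<Sum>i=1..h. L2_inner \<mu> f (e i) * e i x)"
proof -
  have inner: "L2_inner \<mu> (e i) (e j) = of_bool (i = j)" if "i \<in> {1..h}" "j \<in> {1..h}" for i j
    using basis that by (auto simp: orthonormal_basis_def Let_def h_eq)
  have "f \<in> fun_space.span (e ` {1..h})"
    using basis assms by (simp add: orthonormal_basis_def Let_def h_eq)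
  moreover have inj: "inj_on e {1..h}"
    using inner by (intro inj_onI) (metis of_bool_eq_0_iff of_bool_eq_1_iff)
  ultimately obtain a where "f = (\<Sum>v\<in>e ` {1..h}. (\<lambda>x. a v * v x))"
    by (auto simp: fun_space.span_finite)
  then have f: "f = (\<lambda>x. \<Sum>i=1..h. a (e i) * e i x)"
    by (simp add: fun_eq_iff sum_fun_apply sum.reindex[OF inj] del: One_nat_def)
  have "L2_inner \<mu> f (e j) = a (e j)" if "j \<in> {1..h}" for j
  proof -
    have "L2_inner \<mu> f (e j) = (\<Sum>i=1..h. a (e i) * L2_inner \<mu> (e i) (e j))"
      unfolding f using that by (intro L2_inner_sum_left continuous basis_mem)
    also have "\<dots> = (\<Sum>i=1..h. a (e i) * of_bool (i = j))"
      using inner that by (intro sum.cong) auto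
    also have "\<dots> = a (e j)"
      using that by simp
    finally show ?thesis .
  qed
  then show ?thesis
    by (subst f) auto
qed

text \<open>The kernel is the reproducing kernel of \<open>V\<close>, and \<open>G\<close> acts
  unitarily on \<open>V\<close>. With the second point fixed, the translated kernel lies in
  \<open>V\<close> and has the same coefficients \<open>cnj (e j y)\<close> as the original
  one.\<close>

lemma zonal_kernel_act:
  assumes g: "g \<in> carrier G"
  shows "zonal_kernel h e (act g x) (act g y) = zonal_kernel h e x y"
proof -
  define k where "k z = zonal_kernel h e z (act g y)" for z
  have k_eq: "k = (\<lambda>z. \<Sum>i=1..h. cnj (e i (act g y)) * e i z)"
    by (simp add: k_def zonal_kernel_def fun_eq_iff mult.commute)
  have "k = (\<Sum>i=1..h. (\<lambda>z. cnj (e i (act g y)) * e i z))"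
    by (simp add: k_eq fun_eq_iff sum_fun_apply)
  also have "\<dots> \<in> V"
    using basis_mem by (intro fun_space.subspace_sum[OF subspace] fun_space.subspace_scale[OF subspace])
  finally have "k \<in> V" .
  have inv: "inv g \<in> carrier G" and inv_inv: "inv (inv g) = g"
    using g is_group by (auto simp: group.inv_closed group.inv_inv)
  have kg: "(\<lambda>z. k (act g z)) \<in> V"
    using invariant inv \<open>k \<in> V\<close> inv_inv by (fastforce simp: invariant_functions_def)
  have "L2_inner \<mu> (\<lambda>z. k (act g z)) (e j) = cnj (e j y)" if j: "j \<in> {1..h}" for j
  proof -
    \<comment> \<open>Moving \<open>g\<close> to the other side of the inner product replaces
      \<open>e j\<close> by its translate \<open>f\<close>. The reproducing property then evaluates
      \<open>f\<close> at \<open>act g y\<close>, where its value is \<open>e j y\<close>.\<close>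
    define f where "f = (\<lambda>z. e j (act (inv g) z))"
    have f: "f \<in> V"
      using invariant g basis_mem[OF j] by (auto simp: invariant_functions_def f_def)
    have "L2_inner \<mu> (\<lambda>z. k (act g z)) (e j) = L2_inner \<mu> k f"
      unfolding f_def by (intro L2_inner_act continuous \<open>k \<in> V\<close> basis_mem j g)
    also have "\<dots> = (\<Sum>i=1..h. cnj (e i (act g y)) * L2_inner \<mu> (e i) f)"
      unfolding k_eq by (intro L2_inner_sum_left continuous basis_mem f)
    also have "\<dots> = cnj (\<Sum>i=1..h. L2_inner \<mu> f (e i) * e i (act g y))"
      by (subst L2_inner_commute) (simp add: mult.commute)
    also have "\<dots> = cnj (e j y)"
      using expansion[OF f, of "act g y"] act_inv_act[OF g] by (simp add: f_def)
    finally show ?thesis .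
  qed
  then show ?thesis
    using expansion[OF kg, of x] by (simp add: k_def zonal_kernel_def mult.commute)
qed

text \<open>This justifies the \<open>THE\<close> in \<open>zonal_function\<close>. Equal values of
  \<open>\<tau>\<close> mean equal distances, and two-point transitivity with invariance then gives
  equal kernel values.\<close>

lemma zonal_kernel_eq_zonal_function:
  assumes "distance_function \<tau>"
  shows "zonal_kernel h e x y = complex_of_real (zonal_function \<tau> h e (\<tau> x y))"
proof -
  obtain \<phi> where \<phi>: "inj_on \<phi> (range (\<lambda>(x::'a, y). dist x y))" "\<And>x y. \<tau> x y = \<phi> (dist x y)"
    using assms by (auto simp: distance_function_def)
  have kernel_cong: "zonal_kernel h e x' y' = zonal_kernel h e x y" if "\<tau> x' y' = \<tau> x y" for x' y'
  proof -
    have range: "dist a b \<in> range (\<lambda>(x::'a, y). dist x y)" for a b :: 'a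
      by (rule range_eqI[of _ _ "(a, b)"]) simp
    have "dist x y = dist x' y'"
      using inj_onD[OF \<phi>(1) _ range range] that by (simp add: \<phi>(2))
    then obtain g where "g \<in> carrier G" "act g x = x'" "act g y = y'"
      using two_point_transitive by blast
    then show ?thesis
      using zonal_kernel_act by blast
  qed
  \<comment> \<open>The pairs \<open>(x, y)\<close> and \<open>(y, x)\<close> have the same
    distance, so the Hermitian kernel is symmetric and therefore real.\<close>
  have "cnj (zonal_kernel h e x y) = zonal_kernel h e y x"
    by (simp add: zonal_kernel_def mult.commute)
  also have "\<dots> = zonal_kernel h e x y"
    by (rule kernel_cong) (simp add: \<phi>(2) dist_commute)
  finally have "zonal_kernel h e x y \<in> \<real>"
    by (simp add: Reals_cnj_iff)
  then obtain r where r: "zonal_kernel h e x y = complex_of_real r"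
    by (auto elim: Reals_cases)
  have "zonal_function \<tau> h e (\<tau> x y) = r"
    unfolding zonal_function_def
  proof (rule the_equality)
    show "\<forall>x' y'. \<tau> x' y' = \<tau> x y \<longrightarrow> zonal_kernel h e x' y' = complex_of_real r"
      using kernel_cong r by simp
  qed (use r in force)
  with r show ?thesis by simp
qed

end

end

section \<open>Positive semidefiniteness of the zonal kernels and the final bound\<close>

lemma zonal_kernel_psd:
  fixes v :: "'a \<Rightarrow> real"
  shows "0 \<le> Re (\<Sum>x\<in>X. \<Sum>y\<in>X. of_real (v x * v y) * zonal_kernel h e x y)"
proof -
  have "(\<Sum>x\<in>X. \<Sum>y\<in>X. of_real (v x * v y) * zonal_kernel h e x y) =
      (\<Sum>x\<in>X. \<Sum>y\<in>X. \<Sum>i=1..h. (of_real (v x) * e i x) * cnj (of_real (v y) * e i y))"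
    by (simp add: zonal_kernel_def sum_distrib_left mult_ac)
  \<comment> \<open>With \<open>i\<close> outermost, each double sum factors as a complex number
    times its conjugate, so the total is a sum of squared moduli.\<close>
  also have "\<dots> = (\<Sum>i=1..h. \<Sum>x\<in>X. \<Sum>y\<in>X. (of_real (v x) * e i x) * cnj (of_real (v y) * e i y))"
    by (subst sum.swap[of _ _ "{1..h}"], subst sum.swap[of _ _ "{1..h}"]) (rule refl)
  also have "\<dots> = (\<Sum>i=1..h. (\<Sum>x\<in>X. of_real (v x) * e i x) * cnj (\<Sum>x\<in>X. of_real (v x) * e i x))"
    by (simp add: sum_product)
  also have "\<dots> = of_real (\<Sum>i=1..h. (cmod (\<Sum>x\<in>X. of_real (v x) * e i x))\<^sup>2)"
    by (simp only: of_real_sum complex_norm_square)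
  finally show ?thesis
    by (simp add: sum_nonneg)
qed

theorem theorem9:
  fixes G :: "('g, 'm) monoid_scheme" and T :: "'g topology"
    and act :: "'g \<Rightarrow> 'a::metric_space \<Rightarrow> 'a"
    and \<nu> :: "'g measure" and \<mu> :: "'a measure" and x\<^sub>0 :: 'a
    and I :: "nat set" and V :: "nat \<Rightarrow> ('a \<Rightarrow> complex) set"
    and e :: "nat \<Rightarrow> nat \<Rightarrow> 'a \<Rightarrow> complex"
    and \<tau> :: "'a \<Rightarrow> 'a \<Rightarrow> real" and \<tau>\<^sub>0 :: real
    and s K :: nat and X :: "'a set" and \<beta> :: "nat \<Rightarrow> real"
    and F :: "nat set" and c :: "nat \<Rightarrow> real" and P :: "real \<Rightarrow> real"
  assumes "compact_two_point_homogeneous G act T"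
    and "haar_measure G T \<nu>"
    and "\<mu> = induced_measure \<nu> act x\<^sub>0"
    and "harmonic_decomposition G act \<mu> I V"
    and "\<And>k. k \<in> I \<Longrightarrow> orthonormal_basis \<mu> (V k) (e k)"
    and "distance_function \<tau>"
    and "\<And>x. \<tau> x x = \<tau>\<^sub>0"
    and "s \<ge> 2"
    and "s_distance_set s X"
    and "inj_on \<beta> {1..s}"
    and "\<And>x y. x \<in> X \<Longrightarrow> y \<in> X \<Longrightarrow> x \<noteq> y \<Longrightarrow> \<tau> x y \<in> \<beta> ` {1..s}"
    and "span_has_dimension (poly_functions \<tau> (s - 1)) K"
    and "card X > 1 + K * (s - 1)"
    and "finite F" and "F \<subseteq> I"
    and "\<And>k. k \<in> F \<Longrightarrow> c k \<ge> 0"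
    and "P = (\<lambda>t. \<Sum>k\<in>F. c k * zonal_function \<tau> (fun_space.dim (V k)) (e k) t)"
  shows "0 \<le> (real (card X) - 1 - real K * (real s - 1)) *
             (P \<tau>\<^sub>0 + (\<Sum>l=1..s. P (\<beta> l) * k_coeff \<tau>\<^sub>0 s \<beta> l)) \<and>
         (real (card X) - 1 - real K * (real s - 1)) *
             (P \<tau>\<^sub>0 + (\<Sum>l=1..s. P (\<beta> l) * k_coeff \<tau>\<^sub>0 s \<beta> l))
         \<le> real (card X) * P \<tau>\<^sub>0"
proof -
  interpret compact_two_point_homogeneous G act T by fact
  interpret haar_two_point_homogeneous G act T \<nu> \<mu> x\<^sub>0
    by unfold_locales (fact assms(2), fact assms(3))
  define Z where "Z k = zonal_function \<tau> (fun_space.dim (V k)) (e k)" for k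
  have P_eq: "P t = (\<Sum>k\<in>F. c k * Z k t)" for t
    by (simp add: assms(17) Z_def)
  have kernel: "zonal_kernel (fun_space.dim (V k)) (e k) x y = complex_of_real (Z k (\<tau> x y))"
    if "k \<in> F" for k x y
  proof -
    have "k \<in> I" using that assms(15) by blast
    then show ?thesis
      unfolding Z_def using assms(4) assms(5)[of k] assms(6)
      by (intro zonal_kernel_eq_zonal_function[of "V k"])
        (auto simp: harmonic_decomposition_def irreducible_functions_def)
  qed
  have "\<exists>\<phi>. \<forall>x y. \<tau> x y = \<phi> (dist x y)"
    using assms(6) unfolding distance_function_def by blast
  then have \<tau>_sym: "\<tau> x y = \<tau> y x" for x y
    by (metis dist_commute)
  have finX: "finite X"
    using assms(9) by (simp add: s_distance_set_def)
  define B where "B x y = P (\<tau> x y)" for x y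
  have psd: "0 \<le> (\<Sum>x\<in>X. \<Sum>y\<in>X. v x * v y * B x y)" for v
  proof -
    have "0 \<le> c k * (\<Sum>x\<in>X. \<Sum>y\<in>X. v x * v y * Z k (\<tau> x y))" if "k \<in> F" for k
      using zonal_kernel_psd[where X = X and v = v and h = "fun_space.dim (V k)" and e = "e k"]
        assms(16)[OF that]
      by (simp add: kernel[OF that])
    then have "0 \<le> (\<Sum>k\<in>F. c k * (\<Sum>x\<in>X. \<Sum>y\<in>X. v x * v y * Z k (\<tau> x y)))"
      by (rule sum_nonneg)
    also have "\<dots> = (\<Sum>k\<in>F. \<Sum>x\<in>X. \<Sum>y\<in>X. v x * v y * (c k * Z k (\<tau> x y)))"
      by (simp add: sum_distrib_left mult_ac)
    also have "\<dots> = (\<Sum>x\<in>X. \<Sum>y\<in>X. \<Sum>k\<in>F. v x * v y * (c k * Z k (\<tau> x y)))"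
      by (subst sum.swap, subst sum.swap[of _ F]) (rule refl)
    also have "\<dots> = (\<Sum>x\<in>X. \<Sum>y\<in>X. v x * v y * B x y)"
      by (simp add: B_def P_eq sum_distrib_left)
    finally show ?thesis .
  qed
  obtain W where W: "finite W" "card W = K"
    "fun_space.span W = fun_space.span (poly_functions \<tau> (s - 1))"
    using assms(12) by (auto simp: span_has_dimension_def)
  define L where "L = lagrange_poly {1..s} \<beta>"
  define a where "a = P \<tau>\<^sub>0 + (\<Sum>l=1..s. P (\<beta> l) * k_coeff \<tau>\<^sub>0 s \<beta> l)"
  \<comment> \<open>Off the diagonal this is interpolation of \<open>P\<close> at the nodes. On the
    diagonal the Lagrange sum equals minus the sum of the
    \<open>P (\<beta> l) * k_coeff \<tau>\<^sub>0 s \<beta> l\<close>, so \<open>a\<close> is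
    exactly what is missing from \<open>P \<tau>\<^sub>0\<close>.\<close>
  have B_eq: "B x y = (\<Sum>l=1..s. P (\<beta> l) * poly (L l) (\<tau> x y)) + a * of_bool (x = y)"
    if xy: "x \<in> X" "y \<in> X" for x y
  proof (cases "x = y")
    case True
    have "k_coeff \<tau>\<^sub>0 s \<beta> l = - poly (L l) \<tau>\<^sub>0" for l
      by (simp add: k_coeff_def L_def poly_lagrange_poly)
    then show ?thesis
      using True by (simp add: B_def a_def assms(7) sum_negf)
  next
    case False
    then obtain m where "m \<in> {1..s}" "\<tau> x y = \<beta> m"
      using assms(11)[OF xy] by blast
    then show ?thesis
      using False poly_lagrange_expansion[OF _ assms(10), of m P] by (simp add: B_def L_def)
  qed
  have lagrange_orth: "(\<Sum>x\<in>X. v x * poly (L l) (\<tau> x \<xi>)) = 0"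
    if v: "\<And>w. w \<in> W \<Longrightarrow> (\<Sum>x\<in>X. v x * w x) = 0" and l: "l \<in> {1..s}" for v l \<xi>
  proof -
    have "degree (L l) = s - 1"
      using degree_lagrange_poly[OF _ assms(10) l] by (simp add: L_def)
    then have "(\<lambda>x. poly (L l) (\<tau> x \<xi>)) \<in> poly_functions \<tau> (s - 1)"
      by (auto simp: poly_functions_def)
    then have "(\<lambda>x. poly (L l) (\<tau> x \<xi>)) \<in> fun_space.span W"
      using W(3) fun_space.span_base by blast
    \<comment> \<open>The functions orthogonal to \<open>v\<close> on \<open>X\<close> form a
      subspace, so orthogonality passes from \<open>W\<close> to its span, which contains the
      columns of the Lagrange matrices.\<close>
    moreover have "fun_space.subspace {f. (\<Sum>x\<in>X. v x * f x) = 0}"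
    proof (rule fun_space.subspaceI)
      fix r f assume "f \<in> {f. (\<Sum>x\<in>X. v x * f x) = 0}"
      then have "r * (\<Sum>x\<in>X. v x * f x) = 0" by simp
      then show "(\<lambda>x. r * f x) \<in> {f. (\<Sum>x\<in>X. v x * f x) = 0}"
        by (simp add: sum_distrib_left mult.left_commute)
    qed (auto simp: distrib_left sum.distrib)
    ultimately show ?thesis
      using fun_space.span_minimal[of W "{f. (\<Sum>x\<in>X. v x * f x) = 0}"] v by blast
  qed
  \<comment> \<open>All Lagrange terms vanish on \<open>v\<close>. Symmetry of \<open>\<tau>\<close>
    is used to put the summation variable first, as in \<open>poly_functions\<close>.\<close>
  have eig: "(\<Sum>y\<in>X. B x y * v y) = a * v x"
    if x: "x \<in> X" and v: "\<And>w. w \<in> W \<Longrightarrow> (\<Sum>y\<in>X. v y * w y) = 0" for v x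
  proof -
    have "(\<Sum>y\<in>X. B x y * v y) =
        (\<Sum>y\<in>X. \<Sum>l=1..s. P (\<beta> l) * (v y * poly (L l) (\<tau> y x))) + (\<Sum>y\<in>X. a * v y * of_bool (x = y))"
      unfolding sum.distrib[symmetric]
    proof (rule sum.cong)
      fix y assume "y \<in> X"
      have "(\<Sum>l=1..s. P (\<beta> l) * poly (L l) (\<tau> y x)) * v y =
          (\<Sum>l=1..s. P (\<beta> l) * (v y * poly (L l) (\<tau> y x)))"
        unfolding sum_distrib_right by (simp add: mult_ac)
      then show "B x y * v y =
          (\<Sum>l=1..s. P (\<beta> l) * (v y * poly (L l) (\<tau> y x))) + a * v y * of_bool (x = y)"
        using B_eq[OF x \<open>y \<in> X\<close>] by (simp add: distrib_right \<tau>_sym[of x])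
    qed simp
    also have "(\<Sum>y\<in>X. \<Sum>l=1..s. P (\<beta> l) * (v y * poly (L l) (\<tau> y x))) =
        (\<Sum>l=1..s. P (\<beta> l) * (\<Sum>y\<in>X. v y * poly (L l) (\<tau> y x)))"
      by (subst sum.swap) (simp add: sum_distrib_left)
    also have "\<dots> = 0"
      using lagrange_orth[of v, OF v] by simp
    also have "0 + (\<Sum>y\<in>X. a * v y * of_bool (x = y)) = a * v x"
      using x finX by (simp add: of_bool_def if_distrib sum.delta cong: if_cong)
    finally show ?thesis .
  qed
  have K_le: "K \<le> K * (s - 1)"
  proof -
    have "1 \<le> s - 1"
      using assms(8) by linarith
    from mult_le_mono2[OF this, of K] show ?thesis
      by simp
  qed
  then have "card W < card X"
    using assms(13) W(2) by linarith
  then have a: "0 \<le> a" "(real (card X) - real K) * a \<le> (\<Sum>x\<in>X. B x x)"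
    using psd_eigenvalue_trace_bounds[of X W B a] finX W psd eig \<tau>_sym by (auto simp: B_def)
  \<comment> \<open>The subtraction \<open>s - 1\<close> on naturals is not truncated because
    \<open>s\<close> is at least 2.\<close>
  have Ks: "real K * (real s - 1) = real (K * (s - 1))"
    using assms(8) by (simp add: of_nat_diff)
  have "0 \<le> real (card X) - 1 - real (K * (s - 1))"
    using assms(13) by linarith
  moreover have "real (card X) - 1 - real (K * (s - 1)) \<le> real (card X) - real K"
    using K_le by linarith
  moreover have "(\<Sum>x\<in>X. B x x) = real (card X) * P \<tau>\<^sub>0"
    by (simp add: B_def assms(7))
  ultimately show ?thesis
    unfolding a_def[symmetric] Ks using a by (smt (verit) mult_nonneg_nonneg mult_right_mono)
qed

end
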